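(* Let $d\ge1$, $T>0$, and let $B:\mathbb{R}^d\to\mathbb{R}^d$ be monotone, bounded and smooth. Let $h:[0,+\infty)\to[0,+\infty)$ be continuous and non-decreasing with $h(0)=0$. Let $\phi^1,\phi^2\in C^{2,1}_{\mathrm b}(\mathbb{R}^d\times[0,T])$ be solutions of $$\partial_t\phi^i+\Delta\phi^i-B\cdot\nabla\phi^i=0\quad\text{in }\mathbb{R}^d\times(0,T),\qquad i=1,2,$$ such that $$\phi^1(x_1,T)+\phi^2(x_2,T)\le h(|x_1-x_2|)\qquad\forall\,x_1,x_2\in\mathbb{R}^d.$$ Then $$\phi^1(x_1,0)+\phi^2(x_2,0)\le h(|x_1-x_2|)\qquad\forall\,x_1,x_2\in\mathbb{R}^d.$$
   Context: $B$ monotone means $\langle B(x)-B(y),x-y\rangle\ge0$ for all $x,y\in\mathbb{R}^d$. $C^{2,1}_{\mathrm b}(\mathbb{R}^d\times[0,T])$ is the space of functions $\phi(x,t)$ that are bounded and continuous on $\mathbb{R}^d\times[0,T]$ together with their derivatives $\partial_t\phi$, $\nabla_x\phi$, $D_x^2\phi$. $\Delta$ and $\nabla$ act on the space variable $x$. *)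

theory Defs
  imports "HOL-Analysis.Analysis"
begin

(* C^k on the whole space, by recursion on k: f is differentiable everywhere and each of its
   directional derivatives is of class C^(k-1). *)
fun Ck :: "nat \<Rightarrow> ('a::euclidean_space \<Rightarrow> 'b::real_normed_vector) \<Rightarrow> bool" where
  "Ck 0 f \<longleftrightarrow> continuous_on UNIV f"
| "Ck (Suc k) f \<longleftrightarrow>
     (\<forall>x. f differentiable (at x)) \<and>
     (\<forall>v. Ck k (\<lambda>x. frechet_derivative f (at x) v))"

definition smooth :: "('a::euclidean_space \<Rightarrow> 'b::real_normed_vector) \<Rightarrow> bool" where
  "smooth f \<longleftrightarrow> (\<forall>k. Ck k f)"

definition monotone_field :: "('a::real_inner \<Rightarrow> 'a) \<Rightarrow> bool" where
  "monotone_field B \<longleftrightarrow> (\<forall>x y. (B x - B y) \<bullet> (x - y) \<ge> 0)"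

definition gradient :: "(real^'n \<Rightarrow> real) \<Rightarrow> real^'n \<Rightarrow> real^'n" where
  "gradient f x = (\<chi> i. frechet_derivative f (at x) (axis i 1))"

definition hessian :: "(real^'n \<Rightarrow> real) \<Rightarrow> real^'n \<Rightarrow> real^'n^'n" where
  "hessian f x = matrix (frechet_derivative (gradient f) (at x))"

definition laplacian :: "(real^'n \<Rightarrow> real) \<Rightarrow> real^'n \<Rightarrow> real" where
  "laplacian f x = trace (hessian f x)"

(* One-sided at t = 0 and t = T, the ordinary derivative for 0 < t < T. *)
definition time_derivative :: "real \<Rightarrow> ('a \<times> real \<Rightarrow> real) \<Rightarrow> 'a \<Rightarrow> real \<Rightarrow> real" where
  "time_derivative T \<phi> x t = vector_derivative (\<lambda>s. \<phi> (x, s)) (at t within {0..T})"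

definition bounded_continuous_on ::
    "'a::topological_space set \<Rightarrow> ('a \<Rightarrow> 'b::metric_space) \<Rightarrow> bool" where
  "bounded_continuous_on S f \<longleftrightarrow> continuous_on S f \<and> bounded (f ` S)"

(* The space of bounded C^(2,1) functions on R^d x [0,T].  Only the values of \<phi> on this strip
   matter.  The derivative operators above are total, so existence of the derivatives is required separately. *)
definition C21b :: "real \<Rightarrow> ((real^'n) \<times> real \<Rightarrow> real) set" where
  "C21b T = {\<phi>.
     (\<forall>x. \<forall>t\<in>{0..T}.
        (\<lambda>s. \<phi> (x, s)) differentiable (at t within {0..T}) \<and>
        (\<lambda>y. \<phi> (y, t)) differentiable (at x) \<and>
        gradient (\<lambda>y. \<phi> (y, t)) differentiable (at x)) \<and>
     bounded_continuous_on (UNIV \<times> {0..T}) \<phi> \<and>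
     bounded_continuous_on (UNIV \<times> {0..T}) (\<lambda>(x, t). time_derivative T \<phi> x t) \<and>
     bounded_continuous_on (UNIV \<times> {0..T}) (\<lambda>(x, t). gradient (\<lambda>y. \<phi> (y, t)) x) \<and>
     bounded_continuous_on (UNIV \<times> {0..T}) (\<lambda>(x, t). hessian (\<lambda>y. \<phi> (y, t)) x)}"

definition solves_backward_eq ::
    "real \<Rightarrow> (real^'n \<Rightarrow> real^'n) \<Rightarrow> ((real^'n) \<times> real \<Rightarrow> real) \<Rightarrow> bool" where
  "solves_backward_eq T B \<phi> \<longleftrightarrow>
     (\<forall>x. \<forall>t\<in>{0<..<T}.
        time_derivative T \<phi> x t + laplacian (\<lambda>y. \<phi> (y, t)) x
          - B x \<bullet> gradient (\<lambda>y. \<phi> (y, t)) x = 0)"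

end

theory Submission
  imports Defs
begin

text \<open>
  The argument doubles the variables and runs the synchronous coupling: the sum
  \<open>\<phi>1 (x1, t) + \<phi>2 (x2, t)\<close> solves the backward equation of the degenerate operator
  \<open>\<Sum>k. (\<partial>\<^bsub>x1,k\<^esub> + \<partial>\<^bsub>x2,k\<^esub>)\<^sup>2 - B x1 \<bullet> \<nabla>\<^bsub>x1\<^esub> - B x2 \<bullet> \<nabla>\<^bsub>x2\<^esub>\<close>. Its second-order part annihilates functions of
  \<open>x1 - x2\<close>, and by monotonicity of \<open>B\<close> its drift decreases non-decreasing functions of
  \<open>|x1 - x2|\<close>, so these are supersolutions and the maximum principle applies to smooth ones.
  For a pair at distance \<open>r\<close>, the merely continuous \<open>h\<close> is replaced by the smooth barrier
  \<open>h r + \<epsilon> exp (\<kappa> (|x1 - x2|\<^sup>2 - r\<^sup>2))\<close>, which for large \<open>\<kappa>\<close> lies above the terminal data and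
  takes the value \<open>h r + \<epsilon>\<close> at the given pair.
\<close>

section \<open>Gradient, Hessian and the second-order test at a maximum\<close>

lemma has_derivative_gradient:
  fixes f :: "real^'n \<Rightarrow> real"
  assumes "f differentiable (at x)"
  shows "(f has_derivative (\<lambda>v. gradient f x \<bullet> v)) (at x)"
proof -
  let ?D = "frechet_derivative f (at x)"
  have D: "(f has_derivative ?D) (at x)"
    using assms frechet_derivative_works by blast
  then have lin: "linear ?D" by (rule has_derivative_linear)
  have "?D v = gradient f x \<bullet> v" for v
  proof -
    have "?D v = ?D (\<Sum>i\<in>UNIV. v $ i *\<^sub>R axis i 1)"
      using basis_expansion[of v] by (simp add: scalar_mult_eq_scaleR)
    also have "\<dots> = (\<Sum>i\<in>UNIV. v $ i * ?D (axis i 1))"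
      by (simp add: linear_sum[OF lin] linear_cmul[OF lin])
    also have "\<dots> = gradient f x \<bullet> v"
      by (simp add: inner_vec_def gradient_def mult.commute)
    finally show ?thesis .
  qed
  then have "?D = (\<lambda>v. gradient f x \<bullet> v)" by blast
  with D show ?thesis by simp
qed

lemma has_derivative_hessian:
  fixes f :: "real^'n \<Rightarrow> real"
  assumes "gradient f differentiable (at x)"
  shows "(gradient f has_derivative (\<lambda>v. hessian f x *v v)) (at x)"
proof -
  have D: "(gradient f has_derivative frechet_derivative (gradient f) (at x)) (at x)"
    using assms frechet_derivative_works by blast
  then have "linear (frechet_derivative (gradient f) (at x))"
    by (rule has_derivative_linear)
  then have "(\<lambda>v. hessian f x *v v) = frechet_derivative (gradient f) (at x)"
    unfolding hessian_def by (auto simp: matrix_works)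
  with D show ?thesis by simp
qed

lemma DERIV_along_line:
  fixes f :: "real^'n \<Rightarrow> real"
  assumes "f differentiable (at (x + s *\<^sub>R v))"
  shows "((\<lambda>s. f (x + s *\<^sub>R v)) has_real_derivative (gradient f (x + s *\<^sub>R v) \<bullet> v)) (at s)"
proof -
  have "((\<lambda>s. f (x + s *\<^sub>R v)) has_derivative (\<lambda>d. gradient f (x + s *\<^sub>R v) \<bullet> (d *\<^sub>R v))) (at s)"
    by (rule has_derivative_compose[where g = f and f = "\<lambda>s. x + s *\<^sub>R v"])
       (use has_derivative_gradient[OF assms] in \<open>auto intro!: derivative_eq_intros\<close>)
  then show ?thesis
    by (simp add: has_field_derivative_def mult_commute_abs)
qed

text \<open>Identifies the diagonal Hessian entries, whose sum is the Laplacian, with second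
  derivatives along the axes. The parameter value \<open>0\<close> suffices, as the second-order
  test differentiates the first derivative only at the maximum.\<close>

lemma DERIV_gradient_along_line:
  fixes f :: "real^'n \<Rightarrow> real"
  assumes "gradient f differentiable (at x)"
  shows "((\<lambda>s. gradient f (x + s *\<^sub>R axis k 1) \<bullet> axis k 1) has_real_derivative hessian f x $ k $ k) (at 0)"
proof -
  let ?e = "axis k 1 :: real^'n"
  have "((\<lambda>s. gradient f (x + s *\<^sub>R ?e)) has_derivative (\<lambda>d. hessian f x *v (d *\<^sub>R ?e))) (at 0)"
    by (rule has_derivative_compose[where g = "gradient f" and f = "\<lambda>s. x + s *\<^sub>R ?e"])
       (use has_derivative_hessian[OF assms] in \<open>auto intro!: derivative_eq_intros\<close>)
  then have "((\<lambda>s. gradient f (x + s *\<^sub>R ?e) \<bullet> ?e) has_derivative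
      (\<lambda>d. (hessian f x *v (d *\<^sub>R ?e)) \<bullet> ?e)) (at 0)"
    by (rule has_derivative_inner_left)
  moreover have "(hessian f x *v (d *\<^sub>R ?e)) \<bullet> ?e = hessian f x $ k $ k * d" for d
    by (simp add: matrix_vector_mult_scaleR matrix_vector_mul_component inner_axis axis_def[symmetric]
        column_def matrix_vector_mult_basis)
  ultimately show ?thesis
    by (simp add: has_field_derivative_def)
qed

text \<open>If \<open>D > 0\<close>, then \<open>f'\<close>, which vanishes at \<open>a\<close>, is
  positive just to the right of \<open>a\<close>, and the mean value theorem makes \<open>f\<close>
  exceed \<open>f a\<close> there.\<close>

lemma second_derivative_nonpos_at_max:
  fixes f f' :: "real \<Rightarrow> real"
  assumes f: "\<And>s. (f has_real_derivative f' s) (at s)"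
    and D: "(f' has_real_derivative D) (at a)"
    and max: "\<And>s. f s \<le> f a"
  shows "D \<le> 0"
proof (rule ccontr)
  assume "\<not> D \<le> 0"
  then obtain d where d: "d > 0" "\<And>h. h > 0 \<Longrightarrow> h < d \<Longrightarrow> f' a < f' (a + h)"
    using DERIV_pos_inc_right[OF D] by force
  have f'a: "f' a = 0"
    by (rule DERIV_local_max[OF f, of 1]) (use max in auto)
  obtain z where z: "a < z" "z < a + d/2" "f (a + d/2) - f a = (a + d/2 - a) * f' z"
    using MVT2[of a "a + d/2" f f'] f d(1) by auto
  have "f' z > 0" using d(2)[of "z - a"] z f'a d(1) by auto
  then have "(a + d/2 - a) * f' z > 0" using d(1) by simp
  then have "f (a + d/2) > f a" using z(3) by linarith
  then show False using max[of "a + d/2"] by simp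
qed

section \<open>Regularity supplied by membership in \<open>C21b\<close>\<close>

lemma C21b_D:
  assumes "\<phi> \<in> C21b T" "t \<in> {0..T}"
  shows C21b_differentiable: "(\<lambda>y. \<phi> (y, t)) differentiable (at x)"
    and C21b_gradient_differentiable: "gradient (\<lambda>y. \<phi> (y, t)) differentiable (at x)"
  using assms by (auto simp: C21b_def)

lemma C21b_continuous_bounded:
  assumes "\<phi> \<in> C21b T"
  shows C21b_continuous: "continuous_on (UNIV \<times> {0..T}) \<phi>"
    and C21b_bounded: "bounded (\<phi> ` (UNIV \<times> {0..T}))"
  using assms by (auto simp: C21b_def bounded_continuous_on_def)

text \<open>At an interior time the derivative relative to \<open>{0..T}\<close> is the ordinary
  one, so the usual derivative rules apply.\<close>

lemma C21b_DERIV_time: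
  assumes "\<phi> \<in> C21b T" "t \<in> {0<..<T}"
  shows "((\<lambda>s. \<phi> (x, s)) has_real_derivative time_derivative T \<phi> x t) (at t)"
proof -
  have "(\<lambda>s. \<phi> (x, s)) differentiable (at t within {0..T})"
    using assms by (auto simp: C21b_def)
  then have "((\<lambda>s. \<phi> (x, s)) has_vector_derivative time_derivative T \<phi> x t) (at t within {0..T})"
    by (simp add: vector_derivative_works time_derivative_def)
  moreover have "at t within {0..T} = at t"
    using assms(2) by (intro at_within_Icc_at) auto
  ultimately show ?thesis
    by (simp add: has_real_derivative_iff_has_vector_derivative)
qed

section \<open>Maximum principle for the doubled equation\<close>

text \<open>The penalty \<open>\<eta> exp (C (T - t)) (1 + |x1|\<^sup>2 + |x2|\<^sup>2)\<close> forces the maximum to be attained, and for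
  this \<open>C\<close> it is a strict supersolution.\<close>

lemma no_positive_max:
  fixes B :: "real^'n \<Rightarrow> real^'n" and \<phi>1 \<phi>2 :: "(real^'n) \<times> real \<Rightarrow> real"
    and G G' :: "real \<Rightarrow> real"
  assumes mono: "monotone_field B" and bdd: "\<And>x. norm (B x) \<le> M"
    and C21: "\<phi>1 \<in> C21b T" "\<phi>2 \<in> C21b T"
    and eqn: "solves_backward_eq T B \<phi>1" "solves_backward_eq T B \<phi>2"
    and G: "\<And>r. (G has_real_derivative G' r) (at r)" and G': "\<And>r. G' r \<ge> 0"
    and \<eta>: "\<eta> > 0" and C: "C = 4 * real CARD('n) + 2 * M + 1"
  defines "w \<equiv> \<lambda>x1 x2 t. \<phi>1 (x1, t) + \<phi>2 (x2, t) - G ((x1 - x2) \<bullet> (x1 - x2))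
      - \<eta> * exp (C * (T - t)) * (1 + x1 \<bullet> x1 + x2 \<bullet> x2)"
  assumes t: "0 < t" "t < T"
    and max_x: "\<And>y1 y2. w y1 y2 t \<le> w x1 x2 t"
    and max_t: "\<And>s. t \<le> s \<Longrightarrow> s \<le> T \<Longrightarrow> w x1 x2 s \<le> w x1 x2 t"
  shows False
proof -
  define \<psi> where "\<psi> = 1 + x1 \<bullet> x1 + x2 \<bullet> x2"
  define \<eta>' where "\<eta>' = \<eta> * exp (C * (T - t))"
  have \<eta>': "\<eta>' > 0" using \<eta> by (simp add: \<eta>'_def)
  define f1 where "f1 = (\<lambda>y. \<phi>1 (y, t))"
  define f2 where "f2 = (\<lambda>y. \<phi>2 (y, t))"
  have tT: "t \<in> {0..T}" "t \<in> {0<..<T}" using t by auto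
  have d1: "f1 differentiable (at y)" and d2: "f2 differentiable (at y)" for y
    using C21b_differentiable[OF C21(1) tT(1)] C21b_differentiable[OF C21(2) tT(1)]
    by (auto simp: f1_def f2_def)
  have dd1: "gradient f1 differentiable (at y)" and dd2: "gradient f2 differentiable (at y)" for y
    using C21b_gradient_differentiable[OF C21(1) tT(1)] C21b_gradient_differentiable[OF C21(2) tT(1)]
    by (auto simp: f1_def f2_def)

  \<comment> \<open>The maximum is over later times only, so the time derivative of \<open>w\<close>
    need not vanish but cannot be positive. The last term comes from the decreasing factor
    \<open>exp (C * (T - t))\<close>.\<close>
  have time: "time_derivative T \<phi>1 x1 t + time_derivative T \<phi>2 x2 t + \<eta>' * C * \<psi> \<le> 0"
  proof (rule ccontr)
    assume neg: "\<not> ?thesis"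
    have "((\<lambda>s. w x1 x2 s) has_real_derivative
        (time_derivative T \<phi>1 x1 t + time_derivative T \<phi>2 x2 t + \<eta>' * C * \<psi>)) (at t)"
      unfolding w_def
      by (rule DERIV_cong, (rule C21b_DERIV_time[OF C21(1) tT(2)] C21b_DERIV_time[OF C21(2) tT(2)]
          derivative_intros)+) (simp add: \<eta>'_def \<psi>_def)
    then obtain d where d: "d > 0" "\<And>h. h > 0 \<Longrightarrow> h < d \<Longrightarrow> w x1 x2 t < w x1 x2 (t + h)"
      using DERIV_pos_inc_right neg by (metis not_le)
    define e where "e = min (d/2) (T - t)"
    have "0 < e" "e < d" "t + e \<le> T" using d(1) t by (auto simp: e_def min_def)
    then show False using d(2)[of e] max_t[of "t + e"] by simp
  qed

  \<comment> \<open>Both points move by the same vector, so \<open>x1 - x2\<close> is fixed and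
    \<open>G\<close> contributes a constant. The penalty contributes
    \<open>2 * \<eta>' * s^2\<close>, hence the \<open>4 * \<eta>'\<close>.\<close>
  have second: "hessian f1 x1 $ k $ k + hessian f2 x2 $ k $ k - 4 * \<eta>' \<le> 0" for k
  proof -
    let ?e = "axis k 1 :: real^'n"
    let ?g = "\<lambda>s::real. w (x1 + s *\<^sub>R ?e) (x2 + s *\<^sub>R ?e) t"
    let ?g' = "\<lambda>s::real. gradient f1 (x1 + s *\<^sub>R ?e) \<bullet> ?e + gradient f2 (x2 + s *\<^sub>R ?e) \<bullet> ?e
        - \<eta>' * (2 * (x1 \<bullet> ?e) + 2 * (x2 \<bullet> ?e) + 4 * s)"
    have ee: "?e \<bullet> ?e = 1" by (simp add: inner_axis_axis)
    have g_eq: "?g = (\<lambda>s. f1 (x1 + s *\<^sub>R ?e) + f2 (x2 + s *\<^sub>R ?e) - G ((x1 - x2) \<bullet> (x1 - x2))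
        - \<eta>' * (\<psi> + 2 * s * (x1 \<bullet> ?e) + 2 * s * (x2 \<bullet> ?e) + 2 * s^2))"
      unfolding w_def f1_def f2_def \<eta>'_def \<psi>_def
      by (rule ext) (simp add: inner_add_left inner_add_right inner_commute ee power2_eq_square
          algebra_simps inner_axis_axis)
    have "(?g has_real_derivative ?g' s) (at s)" for s
      unfolding g_eq
      by (rule DERIV_cong, (rule DERIV_along_line[OF d1] DERIV_along_line[OF d2] derivative_intros)+) simp
    moreover have "(?g' has_real_derivative hessian f1 x1 $ k $ k + hessian f2 x2 $ k $ k - 4 * \<eta>') (at 0)"
      by (rule DERIV_cong, (rule DERIV_gradient_along_line[OF dd1] DERIV_gradient_along_line[OF dd2]
          derivative_intros)+) simp
    moreover have "?g s \<le> ?g 0" for s using max_x by simp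
    ultimately show ?thesis
      by (rule second_derivative_nonpos_at_max)
  qed
  have "laplacian f1 x1 + laplacian f2 x2 - 4 * \<eta>' * real CARD('n)
      = (\<Sum>k\<in>UNIV. hessian f1 x1 $ k $ k + hessian f2 x2 $ k $ k - 4 * \<eta>')"
    by (simp add: laplacian_def trace_def sum.distrib sum_subtractf)
  also have "\<dots> \<le> 0" by (rule sum_nonpos) (rule second)
  finally have lap: "laplacian f1 x1 + laplacian f2 x2 \<le> 4 * \<eta>' * real CARD('n)" by simp

  define z where "z = x1 - x2"
  define b where "b = B x1 - B x2"
  \<comment> \<open>The derivative of \<open>w\<close> at its spatial maximum, taken in the single
    direction \<open>(- B x1, - B x2)\<close>, vanishes. This yields all drift terms at
    once.\<close>
  have "- (gradient f1 x1 \<bullet> B x1) - gradient f2 x2 \<bullet> B x2 + G' (z \<bullet> z) * (2 * (z \<bullet> b))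
      + \<eta>' * (2 * (x1 \<bullet> B x1) + 2 * (x2 \<bullet> B x2)) = 0"
  proof -
    let ?g = "\<lambda>s::real. w (x1 + s *\<^sub>R (- B x1)) (x2 + s *\<^sub>R (- B x2)) t"
    have g_eq: "?g = (\<lambda>s. f1 (x1 + s *\<^sub>R (- B x1)) + f2 (x2 + s *\<^sub>R (- B x2))
        - G (z \<bullet> z - 2 * s * (z \<bullet> b) + s^2 * (b \<bullet> b))
        - \<eta>' * (\<psi> - 2 * s * (x1 \<bullet> B x1) - 2 * s * (x2 \<bullet> B x2)
            + s^2 * (B x1 \<bullet> B x1) + s^2 * (B x2 \<bullet> B x2)))"
    proof
      fix s
      have "(x1 + s *\<^sub>R (- B x1) - (x2 + s *\<^sub>R (- B x2))) \<bullet> (x1 + s *\<^sub>R (- B x1) - (x2 + s *\<^sub>R (- B x2)))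
          = (z - s *\<^sub>R b) \<bullet> (z - s *\<^sub>R b)"
        by (simp add: z_def b_def algebra_simps)
      also have "\<dots> = z \<bullet> z - 2 * s * (z \<bullet> b) + s^2 * (b \<bullet> b)"
        by (simp add: inner_diff_left inner_diff_right inner_commute power2_eq_square algebra_simps)
      finally have 1: "G ((x1 + s *\<^sub>R (- B x1) - (x2 + s *\<^sub>R (- B x2))) \<bullet> (x1 + s *\<^sub>R (- B x1) - (x2 + s *\<^sub>R (- B x2))))
        = G (z \<bullet> z - 2 * s * (z \<bullet> b) + s^2 * (b \<bullet> b))" by simp
      have sq: "(x + s *\<^sub>R (- y)) \<bullet> (x + s *\<^sub>R (- y)) = x \<bullet> x - 2 * s * (x \<bullet> y) + s^2 * (y \<bullet> y)"
        for x y :: "real^'n"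
        by (simp add: inner_diff_left inner_diff_right inner_commute power2_eq_square algebra_simps)
      show "?g s = f1 (x1 + s *\<^sub>R (- B x1)) + f2 (x2 + s *\<^sub>R (- B x2))
        - G (z \<bullet> z - 2 * s * (z \<bullet> b) + s^2 * (b \<bullet> b))
        - \<eta>' * (\<psi> - 2 * s * (x1 \<bullet> B x1) - 2 * s * (x2 \<bullet> B x2)
            + s^2 * (B x1 \<bullet> B x1) + s^2 * (B x2 \<bullet> B x2))"
        unfolding w_def 1 unfolding sq f1_def f2_def \<eta>'_def \<psi>_def
        by (simp add: algebra_simps)
    qed
    have G0: "(G has_real_derivative G' (z \<bullet> z)) (at (z \<bullet> z - 2 * 0 * (z \<bullet> b) + 0^2 * (b \<bullet> b)))"
      using G[of "z \<bullet> z"] by simp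
    have "(?g has_real_derivative
       - (gradient f1 x1 \<bullet> B x1) - gradient f2 x2 \<bullet> B x2 + G' (z \<bullet> z) * (2 * (z \<bullet> b))
      + \<eta>' * (2 * (x1 \<bullet> B x1) + 2 * (x2 \<bullet> B x2))) (at 0)"
      unfolding g_eq
      by (rule DERIV_cong, (rule DERIV_along_line[OF d1] DERIV_along_line[OF d2] 
          DERIV_chain2[where f = G and g = "\<lambda>s. z \<bullet> z - 2 * s * (z \<bullet> b) + s^2 * (b \<bullet> b)", OF G0]
          derivative_intros)+) (simp add: algebra_simps)
    then show ?thesis
      by (rule DERIV_local_max[of _ _ _ 1]) (use max_x in auto)
  qed
  \<comment> \<open>Here monotonicity of the field meets monotonicity of \<open>G\<close>: both
    factors are nonnegative.\<close>
  moreover have "G' (z \<bullet> z) * (2 * (z \<bullet> b)) \<ge> 0"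
    using mono G' by (auto simp: monotone_field_def z_def b_def inner_commute)
  \<comment> \<open>The drift of the penalty grows only linearly in
    \<open>norm x1 + norm x2\<close>, and \<open>2 * norm x \<le> 1 + x \<bullet> x\<close> bounds
    it by a multiple of \<open>\<psi>\<close>.\<close>
  moreover have "\<eta>' * (2 * (x1 \<bullet> B x1) + 2 * (x2 \<bullet> B x2)) \<ge> - (\<eta>' * (2 * M * \<psi>))"
  proof -
    have M: "M \<ge> 0" using bdd norm_ge_zero order_trans by blast
    have xB: "x \<bullet> B x \<ge> - (norm x * M)" for x
      using Cauchy_Schwarz_ineq2[of x "B x"] mult_left_mono[OF bdd norm_ge_zero, of x x] by linarith
    have nrm: "2 * norm x \<le> 1 + x \<bullet> x" for x :: "real^'n"
      using zero_le_power2[of "norm x - 1"] by (simp add: power2_diff power2_norm_eq_inner)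
    have "norm x1 + norm x2 \<le> \<psi>"
      using nrm[of x1] nrm[of x2] inner_ge_zero[of x1] inner_ge_zero[of x2] unfolding \<psi>_def by linarith
    then have "(norm x1 + norm x2) * M \<le> \<psi> * M" using M by (rule mult_right_mono)
    then have "2 * (x1 \<bullet> B x1) + 2 * (x2 \<bullet> B x2) \<ge> - (2 * M * \<psi>)"
      using xB[of x1] xB[of x2] by (simp add: algebra_simps)
    then show ?thesis using mult_left_mono[of "- (2 * M * \<psi>)" _ \<eta>'] \<eta>' by simp
  qed
  ultimately have drift: "B x1 \<bullet> gradient f1 x1 + B x2 \<bullet> gradient f2 x2 \<ge> - (\<eta>' * (2 * M * \<psi>))"
    unfolding inner_commute[of "B _"] by linarith

  have "time_derivative T \<phi>1 x1 t = B x1 \<bullet> gradient f1 x1 - laplacian f1 x1"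
    "time_derivative T \<phi>2 x2 t = B x2 \<bullet> gradient f2 x2 - laplacian f2 x2"
    using eqn tT(2) by (auto simp: solves_backward_eq_def f1_def f2_def algebra_simps)
  with time lap drift
  have "\<eta>' * C * \<psi> \<le> \<eta>' * (2 * M * \<psi>) + 4 * \<eta>' * real CARD('n)"
    by simp
  \<comment> \<open>This explains \<open>C\<close>: \<open>2 * M\<close> absorbs the drift of the
    penalty, \<open>4 * real CARD('n)\<close> its second-order part (as
    \<open>\<psi> \<ge> 1\<close>), and the remaining \<open>1\<close> makes the inequality
    strict.\<close>
  then have "\<eta>' * (4 * real CARD('n) * (\<psi> - 1) + \<psi>) \<le> 0"
    by (simp add: C algebra_simps)
  moreover have "\<psi> \<ge> 1" by (simp add: \<psi>_def)
  then have "4 * real CARD('n) * (\<psi> - 1) + \<psi> > 0"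
    by (intro add_nonneg_pos) auto
  ultimately show False using \<eta>' by (simp add: mult_le_0_iff)
qed

section \<open>Comparison with a smooth function of the squared distance\<close>

text \<open>A positive value of the penalized difference would force an attained maximum at a time
  in \<open>{t..<T}\<close>, contradicting \<open>no_positive_max\<close>; then the penalty weight
  tends to \<open>0\<close>. Taking \<open>t > 0\<close> keeps that time in the open interval where
  the equation holds. \<open>G\<close> acts on the squared distance, which is smooth also at
  \<open>x1 = x2\<close>.\<close>

lemma comparison_smooth_modulus:
  fixes B :: "real^'n \<Rightarrow> real^'n" and \<phi>1 \<phi>2 :: "(real^'n) \<times> real \<Rightarrow> real"
    and G G' :: "real \<Rightarrow> real"
  assumes mono: "monotone_field B" and bdd: "bounded (range B)"
    and C21: "\<phi>1 \<in> C21b T" "\<phi>2 \<in> C21b T"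
    and eqn: "solves_backward_eq T B \<phi>1" "solves_backward_eq T B \<phi>2"
    and G: "\<And>r. (G has_real_derivative G' r) (at r)" and G': "\<And>r. G' r \<ge> 0"
    and G_nonneg: "\<And>r. G r \<ge> 0"
    and terminal: "\<And>x1 x2. \<phi>1 (x1, T) + \<phi>2 (x2, T) \<le> G ((x1 - x2) \<bullet> (x1 - x2))"
    and t: "0 < t" "t \<le> T"
  shows "\<phi>1 (a1, t) + \<phi>2 (a2, t) \<le> G ((a1 - a2) \<bullet> (a1 - a2))"
proof -
  obtain M where M: "\<And>x. norm (B x) \<le> M"
    using bdd by (auto simp: bounded_iff)
  define C where "C = 4 * real CARD('n) + 2 * M + 1"
  have "M \<ge> 0" using M norm_ge_zero order_trans by blast
  then have C_pos: "C \<ge> 0" by (simp add: C_def)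
  define w where "w = (\<lambda>\<eta> x1 x2 t. \<phi>1 (x1, t) + \<phi>2 (x2, t) - G ((x1 - x2) \<bullet> (x1 - x2))
      - \<eta> * exp (C * (T - t)) * (1 + x1 \<bullet> x1 + x2 \<bullet> x2))"
  have w_le: "w \<eta> a1 a2 t \<le> 0" if \<eta>: "\<eta> > 0" for \<eta>
  proof (rule ccontr)
    assume pos: "\<not> ?thesis"
    obtain N1 where N1: "\<And>x s. s \<in> {0..T} \<Longrightarrow> \<bar>\<phi>1 (x, s)\<bar> \<le> N1"
      using C21b_bounded[OF C21(1)] by (fastforce simp: bounded_iff)
    obtain N2 where N2: "\<And>x s. s \<in> {0..T} \<Longrightarrow> \<bar>\<phi>2 (x, s)\<bar> \<le> N2"
      using C21b_bounded[OF C21(2)] by (fastforce simp: bounded_iff)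
    define N where "N = N1 + N2"
    have N: "\<phi>1 (x, s) + \<phi>2 (y, s) \<le> N" if "s \<in> {0..T}" for x y s
      using N1[OF that, of x] N2[OF that, of y] by (simp add: N_def)
    \<comment> \<open>Chosen so that the penalty beats the bound \<open>N\<close> once a point
      leaves the ball, while \<open>a1\<close> and \<open>a2\<close> lie inside. The summand
      \<open>1\<close> gives \<open>R \<ge> 1\<close>, so that \<open>norm x > R\<close> implies
      \<open>x \<bullet> x \<ge> R\<close>.\<close>
    define R where "R = 1 + \<bar>N\<bar> / \<eta> + norm a1 + norm a2"
    have R1: "R \<ge> 1" using \<eta> by (simp add: R_def)
    have outside: "w \<eta> x1 x2 s \<le> 0" if s: "s \<in> {0..T}" and out: "norm x1 > R \<or> norm x2 > R" for x1 x2 s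
    proof -
      have "norm x1 ^ 2 \<ge> R \<or> norm x2 ^ 2 \<ge> R"
        using out R1 self_le_power[of "norm x1" 2] self_le_power[of "norm x2" 2] by linarith
      then have "R \<le> x1 \<bullet> x1 + x2 \<bullet> x2"
        using inner_ge_zero[of x1] inner_ge_zero[of x2] unfolding power2_norm_eq_inner by linarith
      then have "\<bar>N\<bar> / \<eta> \<le> 1 + x1 \<bullet> x1 + x2 \<bullet> x2"
        using norm_ge_zero[of a1] norm_ge_zero[of a2] unfolding R_def by linarith
      then have "\<bar>N\<bar> \<le> \<eta> * 1 * (1 + x1 \<bullet> x1 + x2 \<bullet> x2)"
        using \<eta> by (simp add: field_simps)
      also have "\<dots> \<le> \<eta> * exp (C * (T - s)) * (1 + x1 \<bullet> x1 + x2 \<bullet> x2)"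
        using \<eta> C_pos s by (intro mult_right_mono mult_left_mono) auto
      finally show ?thesis
        using N[OF s, of x1 x2] G_nonneg[of "(x1 - x2) \<bullet> (x1 - x2)"] by (simp add: w_def)
    qed
    define K where "K = cball (0::real^'n) R \<times> cball (0::real^'n) R \<times> {t..T}"
    have "compact K" unfolding K_def by (intro compact_Times) auto
    moreover have a_in: "(a1, a2, t) \<in> K"
      using t \<eta> by (auto simp: K_def R_def)
    moreover have "continuous_on K (\<lambda>(x1, x2, s). w \<eta> x1 x2 s)"
    proof -
      have c1: "continuous_on K (\<lambda>p. \<phi>1 (fst p, snd (snd p)))"
        by (rule continuous_on_compose2[OF C21b_continuous[OF C21(1)]])
           (use t in \<open>auto simp: K_def intro!: continuous_intros\<close>)
      have c2: "continuous_on K (\<lambda>p. \<phi>2 (fst (snd p), snd (snd p)))"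
        by (rule continuous_on_compose2[OF C21b_continuous[OF C21(2)]])
           (use t in \<open>auto simp: K_def intro!: continuous_intros\<close>)
      have "continuous_on UNIV G"
        using G DERIV_isCont continuous_at_imp_continuous_on by blast
      then have c3: "continuous_on K (\<lambda>p. G ((fst p - fst (snd p)) \<bullet> (fst p - fst (snd p))))"
        by (rule continuous_on_compose2) (auto intro!: continuous_intros)
      show ?thesis
        unfolding w_def split_beta by (intro continuous_intros c1 c2 c3)
    qed
    ultimately obtain p where p: "p \<in> K" "\<And>q. q \<in> K \<Longrightarrow> (case q of (x1, x2, s) \<Rightarrow> w \<eta> x1 x2 s)
        \<le> (case p of (x1, x2, s) \<Rightarrow> w \<eta> x1 x2 s)"
      using continuous_attains_sup[of K] by blast
    obtain x1 x2 s where p_eq: "p = (x1, x2, s)" by (cases p)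
    have max_K: "w \<eta> y1 y2 r \<le> w \<eta> x1 x2 s" if "(y1, y2, r) \<in> K" for y1 y2 r
      using p(2)[OF that] by (simp add: p_eq)
    have w_pos: "w \<eta> x1 x2 s > 0" using max_K[OF a_in] pos by simp
    \<comment> \<open>The maximum over the compact set is global in space, because it is positive
      and \<open>w\<close> is nonpositive outside the balls.\<close>
    have max: "w \<eta> y1 y2 r \<le> w \<eta> x1 x2 s" if "r \<in> {t..T}" for y1 y2 r
    proof (cases "norm y1 > R \<or> norm y2 > R")
      case True
      then show ?thesis using outside[of r y1 y2] that t w_pos by auto
    next
      case False
      then show ?thesis using that by (intro max_K) (auto simp: K_def)
    qed
    have s: "t \<le> s" "s \<le> T" using p(1) by (auto simp: p_eq K_def)
    have "s \<noteq> T"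
    proof
      assume "s = T"
      then have "w \<eta> x1 x2 s \<le> - \<eta> * (1 + x1 \<bullet> x1 + x2 \<bullet> x2)"
        using terminal[of x1 x2] by (simp add: w_def)
      also have "\<dots> \<le> 0" using \<eta> by (simp add: mult_nonpos_nonneg)
      finally show False using w_pos by simp
    qed
    then have s': "0 < s" "s < T" using s t by auto
    show False
      by (rule no_positive_max[OF mono M C21 eqn G G' \<eta> C_def s', of x1 x2])
         (use max s in \<open>auto simp: w_def\<close>)
  qed
  have "\<phi>1 (a1, t) + \<phi>2 (a2, t) - G ((a1 - a2) \<bullet> (a1 - a2)) \<le> \<epsilon>" if "\<epsilon> > 0" for \<epsilon>
  proof -
    \<comment> \<open>The penalty at the given point is \<open>\<eta> * k\<close>, so the weight
      \<open>\<epsilon> / k\<close> makes it exactly \<open>\<epsilon>\<close>.\<close>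
    define k where "k = exp (C * (T - t)) * (1 + a1 \<bullet> a1 + a2 \<bullet> a2)"
    have "k > 0" unfolding k_def by (intro mult_pos_pos) (auto simp: add_pos_nonneg)
    moreover from this have "w (\<epsilon> / k) a1 a2 t \<le> 0" using that by (intro w_le) simp
    ultimately show ?thesis unfolding w_def mult.assoc k_def[symmetric] by simp
  qed
  then show ?thesis using field_le_epsilon[of _ "G ((a1 - a2) \<bullet> (a1 - a2))"] by (simp add: algebra_simps)
qed

section \<open>From smooth barriers to the continuous modulus \<open>h\<close>\<close>

theorem theorem1p5:
  fixes T :: real
    and B :: "real^'n \<Rightarrow> real^'n"
    and h :: "real \<Rightarrow> real"
    and \<phi>1 \<phi>2 :: "(real^'n) \<times> real \<Rightarrow> real"
  assumes "T > 0"
    and "monotone_field B" and "bounded (range B)" and "smooth B"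
    and "continuous_on {0..} h" and "mono_on {0..} h" and "h \<in> {0..} \<rightarrow> {0..}" and "h 0 = 0"
    and "\<phi>1 \<in> C21b T" and "\<phi>2 \<in> C21b T"
    and "solves_backward_eq T B \<phi>1" and "solves_backward_eq T B \<phi>2"
    and "\<forall>x1 x2. \<phi>1 (x1, T) + \<phi>2 (x2, T) \<le> h (norm (x1 - x2))"
  shows "\<forall>x1 x2. \<phi>1 (x1, 0) + \<phi>2 (x2, 0) \<le> h (norm (x1 - x2))"
proof (intro allI)
  fix a1 a2 :: "real^'n"
  define r where "r = norm (a1 - a2)"
  have r: "r \<ge> 0" by (simp add: r_def)
  have hr: "h r \<ge> 0" using assms(7) r by auto
  obtain N1 where N1: "\<And>x. \<bar>\<phi>1 (x, T)\<bar> \<le> N1"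
    using C21b_bounded[OF assms(9)] \<open>T > 0\<close> by (force simp: bounded_iff)
  obtain N2 where N2: "\<And>x. \<bar>\<phi>2 (x, T)\<bar> \<le> N2"
    using C21b_bounded[OF assms(10)] \<open>T > 0\<close> by (force simp: bounded_iff)
  define N where "N = \<bar>N1 + N2\<bar>"
  have N: "\<phi>1 (x, T) + \<phi>2 (y, T) \<le> N" for x y
    using N1[of x] N2[of y] by (simp add: N_def)
  have positive_times: "\<phi>1 (a1, t) + \<phi>2 (a2, t) \<le> h r + \<epsilon>"
    if t: "0 < t" "t \<le> T" and \<epsilon>: "\<epsilon> > 0" for t \<epsilon>
  proof -
    obtain \<delta> where \<delta>: "\<delta> > 0" "\<And>s. s \<ge> 0 \<Longrightarrow> \<bar>s - r\<bar> < \<delta> \<Longrightarrow> \<bar>h s - h r\<bar> < \<epsilon>"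
      using assms(5) r \<epsilon> unfolding continuous_on_iff by (fastforce simp: dist_real_def)
    \<comment> \<open>For distances \<open>s \<ge> r + \<delta>\<close> one has
      \<open>s^2 - r^2 \<ge> \<delta>^2\<close>, so the exponent is at least
      \<open>N / \<epsilon>\<close>; with \<open>exp y \<ge> y\<close> the barrier then exceeds the
      bound \<open>N\<close> on the terminal data.\<close>
    define \<kappa> where "\<kappa> = N / \<epsilon> / \<delta>^2"
    have \<kappa>: "\<kappa> \<ge> 0" using \<epsilon> by (simp add: \<kappa>_def N_def)
    let ?G = "\<lambda>q. h r + \<epsilon> * exp (\<kappa> * (q - r^2))"
    have terminal: "\<phi>1 (x1, T) + \<phi>2 (x2, T) \<le> ?G ((x1 - x2) \<bullet> (x1 - x2))" for x1 x2
    proof -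
      define s where "s = norm (x1 - x2)"
      have s: "s \<ge> 0" "(x1 - x2) \<bullet> (x1 - x2) = s^2" by (auto simp: s_def power2_norm_eq_inner)
      have le_h: "\<phi>1 (x1, T) + \<phi>2 (x2, T) \<le> h s" using assms(13) by (simp add: s_def)
      \<comment> \<open>Up to \<open>r\<close> the barrier dominates since \<open>h\<close> is
        non-decreasing, slightly beyond \<open>r\<close> by continuity of \<open>h\<close> at
        \<open>r\<close>, and far away by boundedness of the terminal data.\<close>
      consider "s \<le> r" | "r < s" "s < r + \<delta>" | "s \<ge> r + \<delta>" by linarith
      then show ?thesis
      proof cases
        case 1
        then have "h s \<le> h r" using assms(6) s(1) r by (auto simp: mono_on_def)
        then show ?thesis using le_h \<epsilon> by (simp add: add_increasing2)
      next
        case 2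
        then have "h s \<le> h r + \<epsilon>" using \<delta>(2)[of s] s(1) by simp
        moreover have "\<epsilon> * 1 \<le> \<epsilon> * exp (\<kappa> * (s^2 - r^2))"
          using \<epsilon> \<kappa> 2 r by (intro mult_left_mono) (auto intro!: power_mono)
        ultimately show ?thesis using le_h s(2) by simp
      next
        case 3
        have "(r + \<delta>)^2 \<le> s^2" using 3 r \<delta>(1) by (intro power_mono) auto
        moreover have "(r + \<delta>)^2 \<ge> r^2 + \<delta>^2"
          using r \<delta>(1) by (simp add: power2_sum)
        ultimately have "\<kappa> * \<delta>^2 \<le> \<kappa> * (s^2 - r^2)" using \<kappa> by (intro mult_left_mono) auto
        then have "N / \<epsilon> \<le> \<kappa> * (s^2 - r^2)" using \<delta>(1) by (simp add: \<kappa>_def)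
        also have "\<dots> \<le> exp (\<kappa> * (s^2 - r^2))"
          using exp_ge_add_one_self[of "\<kappa> * (s^2 - r^2)"] by linarith
        finally have "N \<le> \<epsilon> * exp (\<kappa> * (s^2 - r^2))"
          using \<epsilon> by (simp add: field_simps)
        then show ?thesis using N[of x1 x2] hr s(2) by simp
      qed
    qed
    have "\<phi>1 (a1, t) + \<phi>2 (a2, t) \<le> ?G ((a1 - a2) \<bullet> (a1 - a2))"
    proof (rule comparison_smooth_modulus[OF assms(2,3,9-12) _ _ _ terminal t])
      show "(?G has_real_derivative \<epsilon> * (\<kappa> * exp (\<kappa> * (q - r^2)))) (at q)" for q
        by (auto intro!: derivative_eq_intros)
    qed (use \<epsilon> \<kappa> hr in auto)
    then show ?thesis by (simp add: r_def power2_norm_eq_inner)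
  qed
  \<comment> \<open>The comparison covers only positive times; time \<open>0\<close> is reached by
    continuity, after letting \<open>\<epsilon>\<close> tend to \<open>0\<close> at each fixed
    \<open>t\<close>.\<close>
  have "continuous_on {0..T} (\<lambda>t. \<phi>1 (a1, t) + \<phi>2 (a2, t))"
    by (intro continuous_on_add continuous_on_compose2[OF C21b_continuous[OF assms(9)]]
        continuous_on_compose2[OF C21b_continuous[OF assms(10)]])
       (auto intro!: continuous_intros)
  then have "((\<lambda>t. \<phi>1 (a1, t) + \<phi>2 (a2, t)) \<longlongrightarrow> \<phi>1 (a1, 0) + \<phi>2 (a2, 0)) (at_right 0)"
    using \<open>T > 0\<close> by (rule continuous_on_Icc_at_rightD)
  moreover have "\<forall>\<^sub>F t in at_right 0. \<phi>1 (a1, t) + \<phi>2 (a2, t) \<le> h r"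
    using eventually_at_right_real[OF \<open>T > 0\<close>]
  proof eventually_elim
    case (elim t)
    then show ?case by (intro field_le_epsilon[OF positive_times]) auto
  qed
  ultimately show "\<phi>1 (a1, 0) + \<phi>2 (a2, 0) \<le> h (norm (a1 - a2))"
    unfolding r_def[symmetric] by (rule tendsto_upperbound) simp
qed

end
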